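(* Let $p>1$ be an integer. (i) If $G$ is a minimally 2-connected graph with $n\geq 4$ vertices, then $e_p(G)\leq 2(n-2)^p+(n-2)2^p$, with equality if and only if $G\cong K_{2,n-2}$. (ii) If $G$ is a minimally 2-edge-connected graph with $n\geq 4$ vertices, then $e_p(G)\leq \max\{e_p(F_n),e_p(K_{2,n-2})\}$, with equality if and only if $G\cong K_{2,n-2}$ or ($n$ is odd and $G\cong F_n$).
   Context: All graphs are finite, undirected and simple. For a graph $G$, $e_p(G)=\sum_{v\in V(G)} d_G(v)^p$, where $d_G(v)$ is the degree of $v$. A graph is $t$-connected (resp. $t$-edge-connected) if removing fewer than $t$ vertices (resp. edges) always leaves a connected graph; it is minimally $t$-connected (resp. minimally $t$-edge-connected) if it is $t$-connected (resp. $t$-edge-connected) and deleting any edge yields a graph that is not $t$-connected (resp. not $t$-edge-connected). $K_{2,n-2}$ is the complete bipartite graph with parts of sizes $2$ and $n-2$. The friendship graph $F_n$ is obtained from the star $S_n$ on $n$ vertices by adding a maximum matching on the set of its leaves.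
   Formalization: In (ii) the equality case is corrected: each of K_{2,n-2} and F_n (n odd) is listed as extremal only when it attains the maximum; as printed the "if" direction fails, e.g. n=5, p=2, G=K_{2,3} has e_2=30<32=e_2(F_5). *)

theory Defs
  imports "Graph_Theory.Graph_Theory"
begin

text \<open>
  A finite simple undirected graph is a \<^locale>\<open>pair_graph\<close>: a finite loop-free symmetric relation,
  where the undirected edge \<open>{u,v}\<close> is represented by the two arcs \<open>(u,v)\<close> and \<open>(v,u)\<close>.
  In particular the degree of a vertex is its out-degree.
\<close>

definition degree_power :: "nat \<Rightarrow> 'a pair_pre_digraph \<Rightarrow> nat" where
  "degree_power p G = (\<Sum>v\<in>pverts G. out_degree G v ^ p)"

definition uedges :: "'a pair_pre_digraph \<Rightarrow> 'a set set" where
  "uedges G = (\<lambda>(u,v). {u,v}) ` parcs G"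

definition del_edges :: "'a pair_pre_digraph \<Rightarrow> 'a set set \<Rightarrow> 'a pair_pre_digraph" where
  "del_edges G F = \<lparr> pverts = pverts G, parcs = {(u,v) \<in> parcs G. {u,v} \<notin> F} \<rparr>"

text \<open>
  No lower bound on the number of vertices is imposed; \<^const>\<open>connected\<close> excludes the null graph.
\<close>

definition vertex_connected :: "nat \<Rightarrow> 'a pair_pre_digraph \<Rightarrow> bool" where
  "vertex_connected t G \<longleftrightarrow>
     (\<forall>S. S \<subseteq> pverts G \<and> finite S \<and> card S < t \<longrightarrow>
       connected (induce_subgraph (with_proj G) (pverts G - S)))"

definition edge_connected :: "nat \<Rightarrow> 'a pair_pre_digraph \<Rightarrow> bool" where
  "edge_connected t G \<longleftrightarrow>
     (\<forall>F. F \<subseteq> uedges G \<and> finite F \<and> card F < t \<longrightarrow> connected (with_proj (del_edges G F)))"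

definition minimally_vertex_connected :: "nat \<Rightarrow> 'a pair_pre_digraph \<Rightarrow> bool" where
  "minimally_vertex_connected t G \<longleftrightarrow>
     vertex_connected t G \<and> (\<forall>e\<in>uedges G. \<not> vertex_connected t (del_edges G {e}))"

definition minimally_edge_connected :: "nat \<Rightarrow> 'a pair_pre_digraph \<Rightarrow> bool" where
  "minimally_edge_connected t G \<longleftrightarrow>
     edge_connected t G \<and> (\<forall>e\<in>uedges G. \<not> edge_connected t (del_edges G {e}))"

definition graph_iso :: "'a pair_pre_digraph \<Rightarrow> 'b pair_pre_digraph \<Rightarrow> bool" where
  "graph_iso G H \<longleftrightarrow> digraph_iso (with_proj G) (with_proj H)"

definition bipartite_graph :: "nat \<Rightarrow> nat \<Rightarrow> nat pair_pre_digraph" where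
  "bipartite_graph a b =
     \<lparr> pverts = {..<a+b}, parcs = {..<a} \<times> {a..<a+b} \<union> {a..<a+b} \<times> {..<a} \<rparr>"

text \<open>
  Star with centre \<open>0\<close> and leaves \<open>1, \<dots>, n-1\<close>, together with the matching
  \<open>{1,2}, {3,4}, \<dots>\<close> of the leaves; for even \<open>n\<close> the leaf \<open>n-1\<close> stays unmatched.
\<close>

definition friendship_graph :: "nat \<Rightarrow> nat pair_pre_digraph" where
  "friendship_graph n =
     \<lparr> pverts = {..<n},
       parcs = {0} \<times> {1..<n} \<union> {1..<n} \<times> {0}
         \<union> {(2*i+1, 2*i+2) | i. 2*i+2 < n} \<union> {(2*i+2, 2*i+1) | i. 2*i+2 < n} \<rparr>"

lemma complete_bipartite_bipartite_graph:
  "complete_bipartite_digraph a b (with_proj (bipartite_graph a b))"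
  unfolding complete_bipartite_digraph_pair_def
  by (rule conjI, simp add: bipartite_graph_def,
      rule exI[of _ "{..<a}"], rule exI[of _ "{a..<a+b}"]) (auto simp: bipartite_graph_def)

lemma pair_graph_friendship_graph: "pair_graph (friendship_graph n)"
proof -
  have "parcs (friendship_graph n) \<subseteq> {..<n} \<times> {..<n}"
    by (auto simp: friendship_graph_def)
  then have "finite (parcs (friendship_graph n))"
    by (rule finite_subset) simp
  then show ?thesis
    by unfold_locales (auto simp: friendship_graph_def symmetric_def sym_def)
qed

end

theory Submission
  imports Defs
begin

text \<open>
  If a cycle has a chord, deleting the chord keeps the graph 2-connected (2-edge-connected), because
  the ends of the chord stay joined along the cycle. Hence minimality forbids chorded cycles, while
  connectivity forces all degrees to be at least 2. A graph of minimum degree 3 has a chorded cycle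
  (close up a longest path at one of its ends), so, removing vertices of degree at most 2, a graph
  on \<open>n \<ge> 4\<close> vertices without chorded cycles has at most \<open>2n - 4\<close> edges (Posa). If all degrees
  are at most \<open>n - 2\<close>, convexity of \<open>x ^ p\<close> then bounds the degree power by the case of two vertices
  of degree \<open>n - 2\<close> and \<open>n - 2\<close> vertices of degree 2, and equality forces \<open>K\<^sub>2\<^sub>,\<^sub>n\<^sub>-\<^sub>2\<close>. If instead
  some vertex is adjacent to all others, the remaining vertices have no path of length 2 among them,
  so they are perfectly matched and the graph is a friendship graph, which has a cut vertex.
\<close>

subsection \<open>Chorded cycles\<close>

text \<open>
  The cycle is \<open>u, xs, v, ys, u\<close>; non-emptiness of both arcs makes \<open>uv\<close> a chord.
\<close>

definition chorded_cycle :: "'a rel \<Rightarrow> bool" where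
  "chorded_cycle E \<longleftrightarrow> (\<exists>u v xs ys. (u,v) \<in> E \<and> xs \<noteq> [] \<and> ys \<noteq> [] \<and> distinct (u # xs @ v # ys) \<and>
     successively (\<lambda>x y. (x,y) \<in> E) (u # xs @ v # ys @ [u]))"

lemma chorded_cycleI:
  assumes "(u,v) \<in> E" "xs \<noteq> []" "ys \<noteq> []" "distinct (u # xs @ v # ys)"
    "successively (\<lambda>x y. (x,y) \<in> E) (u # xs @ v # ys @ [u])"
  shows "chorded_cycle E"
  using assms unfolding chorded_cycle_def by blast

lemma chorded_cycle_mono:
  assumes "chorded_cycle E" "E \<subseteq> E'"
  shows "chorded_cycle E'"
proof -
  obtain u v xs ys where c: "(u,v) \<in> E" "xs \<noteq> []" "ys \<noteq> []" "distinct (u # xs @ v # ys)"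
    "successively (\<lambda>x y. (x,y) \<in> E) (u # xs @ v # ys @ [u])"
    using assms(1) unfolding chorded_cycle_def by blast
  have "successively (\<lambda>x y. (x,y) \<in> E') (u # xs @ v # ys @ [u])"
    using c(5) by (rule successively_mono) (use assms(2) in auto)
  with c assms(2) show ?thesis by (intro chorded_cycleI) auto
qed

text \<open>Serves to name two chosen neighbours by their order along a path; the order is unknown
  beforehand, so only the unordered pair is fixed.\<close>

lemma split_list_two:
  assumes "a \<in> set r" "b \<in> set r" "a \<noteq> b"
  obtains p x q y s where "r = p @ x # q @ y # s" "{x,y} = {a,b}"
proof -
  obtain p t where r: "r = p @ a # t" using assms(1) by (meson split_list)
  consider "b \<in> set p" | "b \<in> set t" using r assms by auto
  then show thesis
  proof cases
    case 1
    then obtain p1 p2 where "p = p1 @ b # p2" by (meson split_list)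
    with r that[of p1 b p2 a t] show thesis by auto
  next
    case 2
    then obtain p1 p2 where "t = p1 @ b # p2" by (meson split_list)
    with r that[of p a p1 b p2] show thesis by auto
  qed
qed

text \<open>Let \<open>v0\<close> begin a longest path. Its neighbours all lie on the path, and
  besides the second vertex \<open>v1\<close> there are at least two, \<open>x\<close> before
  \<open>y\<close>. Closing the path at \<open>y\<close> back to \<open>v0\<close> gives a cycle on
  which \<open>v0\<close>, \<open>x\<close> are joined by a chord, with \<open>v1\<close> on one
  side and \<open>y\<close> on the other.\<close>

lemma chorded_cycle_if_degree_ge_3:
  assumes fin: "finite V" and ne: "V \<noteq> {}" and sub: "E \<subseteq> V \<times> V" and sym: "sym E" and irr: "irrefl E"
    and deg: "\<And>v. v \<in> V \<Longrightarrow> 3 \<le> card (E `` {v})"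
  shows "chorded_cycle E"
proof -
  define Q where "Q xs \<longleftrightarrow> xs \<noteq> [] \<and> set xs \<subseteq> V \<and> distinct xs \<and> successively (\<lambda>x y. (x,y) \<in> E) xs" for xs
  obtain v where "v \<in> V" using ne by blast
  then have "Q [v]" by (simp add: Q_def)
  moreover have "\<forall>xs. Q xs \<longrightarrow> length xs < Suc (card V)"
    using card_mono[OF fin] distinct_card by (metis Q_def less_Suc_eq_le)
  ultimately obtain l where l: "Q l" and max: "\<And>xs. Q xs \<Longrightarrow> length xs \<le> length l"
    using ex_has_greatest_nat[of Q "[v]" length] by blast
  obtain v0 r0 where r0: "l = v0 # r0" using l by (cases l) (auto simp: Q_def)
  have v0: "v0 \<in> V" using l r0 by (simp add: Q_def)
  \<comment> \<open>A longest path contains all neighbours of its first vertex.\<close>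
  have nb: "E `` {v0} \<subseteq> set r0"
  proof
    fix w assume w: "w \<in> E `` {v0}"
    then have wE: "(w,v0) \<in> E" "w \<in> V" "w \<noteq> v0" using sym sub irr by (auto simp: sym_def irrefl_def)
    show "w \<in> set r0"
    proof (rule ccontr)
      assume "w \<notin> set r0"
      then have "Q (w # l)" using l wE r0 by (auto simp: Q_def)
      then show False using max[of "w # l"] by simp
    qed
  qed
  have d3: "3 \<le> card (E `` {v0})" using deg v0 by blast
  then have "r0 \<noteq> []" using nb by auto
  then obtain v1 r where r: "r0 = v1 # r" by (cases r0) auto
  have "2 \<le> card (E `` {v0} - {v1})" using d3 by (simp add: card_Diff_singleton_if) linarith
  then obtain a b where ab: "a \<in> E `` {v0} - {v1}" "b \<in> E `` {v0} - {v1}" "a \<noteq> b"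
    by (metis card_2_iff card_Ex_subset insert_subset)
  then have "a \<in> set r" "b \<in> set r" using nb r by auto
  then obtain p x q y s where s: "r = p @ x # q @ y # s" "{x,y} = {a,b}"
    using split_list_two ab(3) by metis
  have xy: "(v0,x) \<in> E" "(y,v0) \<in> E" using ab s(2) sym by (auto simp: doubleton_eq_iff sym_def)
  show ?thesis
  proof (rule chorded_cycleI[of v0 x _ "v1 # p" "q @ [y]"])
    show "distinct (v0 # (v1 # p) @ x # q @ [y])"
      using l r0 r s by (auto simp: Q_def)
    have "successively (\<lambda>x y. (x,y) \<in> E) ((v0 # v1 # p @ x # q @ [y]) @ s)"
      using l r0 r s by (simp add: Q_def)
    then have "successively (\<lambda>x y. (x,y) \<in> E) (v0 # v1 # p @ x # q @ [y])"
      by (subst (asm) successively_append_iff) blast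
    then have "successively (\<lambda>x y. (x,y) \<in> E) ((v0 # v1 # p @ x # q @ [y]) @ [v0])"
      using xy by (subst successively_append_iff) simp
    then show "successively (\<lambda>x y. (x,y) \<in> E) (v0 # (v1 # p) @ x # (q @ [y]) @ [v0])" by simp
  qed (use xy in auto)
qed

section \<open>Posa's edge bound\<close>

text \<open>Handshake count in terms of arcs: a symmetric \<open>E\<close> holds every edge twice,
  so the edge bounds below appear doubled.\<close>

lemma card_rel_eq_sum_degree:
  assumes "finite V" "E \<subseteq> V \<times> V"
  shows "card E = (\<Sum>v\<in>V. card (E `` {v}))"
proof -
  have "E = Sigma V (\<lambda>v. E `` {v})" using assms by auto
  then have "card E = card (Sigma V (\<lambda>v. E `` {v}))" by simp
  also have "\<dots> = (\<Sum>v\<in>V. card (E `` {v}))"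
    using assms by (intro card_SigmaI) (auto intro: finite_subset[of _ V])
  finally show ?thesis .
qed

lemma card_rel_delete_vertex:
  assumes "finite E" "sym E"
  shows "card E \<le> card {(x,y) \<in> E. x \<noteq> v \<and> y \<noteq> v} + 2 * card (E `` {v})"
proof -
  let ?N = "E `` {v}"
  have fN: "finite ?N" using assms(1) by simp
  have fE: "finite {(x,y) \<in> E. x \<noteq> v \<and> y \<noteq> v}"
    using assms(1) by (rule rev_finite_subset) auto
  have "E \<subseteq> {(x,y) \<in> E. x \<noteq> v \<and> y \<noteq> v} \<union> ({v} \<times> ?N \<union> ?N \<times> {v})"
    using assms(2) by (auto simp: sym_def)
  moreover have "finite ({(x,y) \<in> E. x \<noteq> v \<and> y \<noteq> v} \<union> ({v} \<times> ?N \<union> ?N \<times> {v}))"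
    using fE fN by (intro finite_UnI finite_cartesian_product) auto
  ultimately have "card E \<le> card ({(x,y) \<in> E. x \<noteq> v \<and> y \<noteq> v} \<union> ({v} \<times> ?N \<union> ?N \<times> {v}))"
    by (intro card_mono)
  also have "\<dots> \<le> card {(x,y) \<in> E. x \<noteq> v \<and> y \<noteq> v} + (card ({v} \<times> ?N) + card (?N \<times> {v}))"
    by (rule order_trans[OF card_Un_le add_left_mono[OF card_Un_le]])
  also have "\<dots> = card {(x,y) \<in> E. x \<noteq> v \<and> y \<noteq> v} + 2 * card ?N"
    by (simp add: card_cartesian_product)
  finally show ?thesis .
qed

text \<open>Supplies the base of the induction below, where deleting one of four vertices leaves
  three; a missing edge costs two arcs.\<close>

lemma card_three_vertices_le:
  assumes V: "V = {a,b,c}" "a \<noteq> b" "a \<noteq> c" "b \<noteq> c" and E: "E \<subseteq> V \<times> V" "sym E" "irrefl E"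
  shows "card E \<le> 6" and "(a,b) \<notin> E \<or> (a,c) \<notin> E \<or> (b,c) \<notin> E \<Longrightarrow> card E \<le> 4"
proof -
  have sub: "E \<subseteq> {(a,b),(b,a),(a,c),(c,a),(b,c),(c,b)}"
    using V E by (auto simp: irrefl_def)
  then have "card E \<le> card {(a,b),(b,a),(a,c),(c,a),(b,c),(c,b)}" by (intro card_mono) auto
  then show "card E \<le> 6" using V by simp
  have le: "card E \<le> 4" if "E \<subseteq> {w,x,y,z}" for w x y z
    using card_mono[OF _ that] card_length[of "[w,x,y,z]"] by simp
  assume "(a,b) \<notin> E \<or> (a,c) \<notin> E \<or> (b,c) \<notin> E"
  then consider "(a,b) \<notin> E" "(b,a) \<notin> E" | "(a,c) \<notin> E" "(c,a) \<notin> E" | "(b,c) \<notin> E" "(c,b) \<notin> E"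
    using E(2) by (auto simp: sym_def)
  then show "card E \<le> 4"
  proof cases
    case 1 with sub show ?thesis by (intro le[of "(a,c)" "(c,a)" "(b,c)" "(c,b)"]) auto
  next
    case 2 with sub show ?thesis by (intro le[of "(a,b)" "(b,a)" "(b,c)" "(c,b)"]) auto
  next
    case 3 with sub show ?thesis by (intro le[of "(a,b)" "(b,a)" "(a,c)" "(c,a)"]) auto
  qed
qed

text \<open>This is the bound of \<open>2n - 4\<close> edges, counted in arcs. Some vertex has
  degree at most 2, and deleting it loses at most 4 arcs, exactly the change of the right-hand
  side.\<close>

theorem Posa_chorded_cycle_bound:
  assumes "finite V" "4 \<le> card V" "E \<subseteq> V \<times> V" "sym E" "irrefl E" "\<not> chorded_cycle E"
  shows "card E + 8 \<le> 4 * card V"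
proof -
  obtain k where "card V = 4 + k" using assms(2) le_Suc_ex by blast
  then show ?thesis using assms(1,3-6)
  proof (induction k arbitrary: V E)
    case base: 0
    then have finE: "finite E" by (meson finite_SigmaI finite_subset)
    have "V \<noteq> {}" using base by auto
    then obtain v where v: "v \<in> V" "card (E `` {v}) < 3"
      using chorded_cycle_if_degree_ge_3[of V E] base by force
    let ?E = "{(x,y) \<in> E. x \<noteq> v \<and> y \<noteq> v}"
    have E': "?E \<subseteq> (V - {v}) \<times> (V - {v})" "sym ?E" "irrefl ?E"
      using base by (auto simp: sym_def irrefl_def)
    have c3: "card (V - {v}) = 3" using base v by simp
    have le: "card E \<le> card ?E + 2 * card (E `` {v})"
      by (rule card_rel_delete_vertex[OF finE \<open>sym E\<close>])
    \<comment> \<open>The bound is now 8 arcs. If \<open>v\<close> has degree at most 1, the crude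
      count 6 + 2 suffices; degree 2 contributes 4 arcs, so the other three vertices must not form a
      triangle.\<close>
    show ?case
    proof (cases "card (E `` {v}) = 2")
      case False
      obtain a b c where abc: "V - {v} = {a,b,c}" "a \<noteq> b" "a \<noteq> c" "b \<noteq> c"
        using c3 by (auto simp: card_3_iff)
      from card_three_vertices_le(1)[OF this E'] le False v base(1) show ?thesis by linarith
    next
      case True
      then obtain a b where ab: "E `` {v} = {a,b}" "a \<noteq> b" by (auto simp: card_2_iff)
      have abV: "{a,b} \<subseteq> V - {v}" using ab base by (auto simp: irrefl_def)
      have "card (V - {v} - {a,b}) = 1" using c3 abV ab
        by (subst card_Diff_subset) auto
      then obtain c where c: "V - {v} - {a,b} = {c}" by (auto simp: card_1_singleton_iff)
      have abc: "V - {v} = {a,b,c}" "a \<noteq> b" "a \<noteq> c" "b \<noteq> c" using c abV ab by auto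
      have vab: "(v,a) \<in> E" "(b,v) \<in> E" using ab base by (auto simp: sym_def)
      \<comment> \<open>Otherwise \<open>a, c, b, v\<close> is a 4-cycle with chord
        \<open>ab\<close>.\<close>
      have "(a,b) \<notin> ?E \<or> (a,c) \<notin> ?E \<or> (b,c) \<notin> ?E"
      proof (rule ccontr)
        assume "\<not> ?thesis"
        then have "(a,b) \<in> E" "(a,c) \<in> E" "(c,b) \<in> E" "(a,v) \<in> E" "(v,b) \<in> E"
          using \<open>sym E\<close> vab by (auto simp: sym_def)
        then have "chorded_cycle E" using abc vab \<open>sym E\<close>
          by (intro chorded_cycleI[of a b E "[c]" "[v]"]) (auto simp: sym_def)
        then show False using base by blast
      qed
      from card_three_vertices_le(2)[OF abc E' this] True le base(1) show ?thesis by linarith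
    qed
  next
    case step: (Suc k)
    then have finE: "finite E" by (meson finite_SigmaI finite_subset)
    have "V \<noteq> {}" using step by auto
    then obtain v where v: "v \<in> V" "card (E `` {v}) < 3"
      using chorded_cycle_if_degree_ge_3[of V E] step by force
    let ?E = "{(x,y) \<in> E. x \<noteq> v \<and> y \<noteq> v}"
    have "card E \<le> card ?E + 2 * card (E `` {v})"
      by (rule card_rel_delete_vertex[OF finE \<open>sym E\<close>])
    moreover have "\<not> chorded_cycle ?E" using chorded_cycle_mono[of ?E E] step by blast
    then have "card ?E + 8 \<le> 4 * card (V - {v})"
      using step v by (intro step.IH) (auto simp: sym_def irrefl_def)
    ultimately show ?case using v step by simp
  qed
qed

subsection \<open>Convexity\<close>

text \<open>Multiplying the inequality for \<open>p\<close> by \<open>d\<close> gives the one for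
  \<open>Suc p\<close> with an explicit surplus. Keeping the surplus serves both the weak and the
  strict version.\<close>

lemma power_secant_step:
  fixes d N :: int
  shows "(N - 2) * d ^ p \<le> (N - d) * 2 ^ p + (d - 2) * N ^ p \<Longrightarrow> 2 \<le> d \<Longrightarrow>
    (N - 2) * d ^ Suc p + (N - d) * (d - 2) * (N ^ p - 2 ^ p) \<le> (N - d) * 2 ^ Suc p + (d - 2) * N ^ Suc p"
proof -
  assume h: "(N - 2) * d ^ p \<le> (N - d) * 2 ^ p + (d - 2) * N ^ p" "2 \<le> d"
  have "d * ((N - 2) * d ^ p) \<le> d * ((N - d) * 2 ^ p + (d - 2) * N ^ p)"
    using h by (intro mult_left_mono) auto
  then show ?thesis by (simp add: algebra_simps)
qed

text \<open>Convexity without fractions: between 2 and \<open>N\<close> the function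
  \<open>x ^ p\<close> lies below its secant, here multiplied by \<open>N - 2\<close>. Integers
  avoid truncated differences.\<close>

lemma power_secant_le:
  fixes d N :: int
  assumes "2 \<le> d" "d \<le> N" "1 \<le> p"
  shows "(N - 2) * d ^ p \<le> (N - d) * 2 ^ p + (d - 2) * N ^ p"
  using assms(3)
proof (induction p rule: dec_induct)
  case base
  show ?case by (simp add: algebra_simps)
next
  case (step p)
  have "0 \<le> (N - d) * (d - 2) * (N ^ p - 2 ^ p)" using assms by (simp add: power_mono)
  with power_secant_step[OF step.IH assms(1)] show ?case by linarith
qed

text \<open>Strictly between the ends the surplus of the last induction step is positive, once the
  exponent is at least 2.\<close>

lemma power_secant_less:
  fixes d N :: int
  assumes "2 < d" "d < N" "2 \<le> p"
  shows "(N - 2) * d ^ p < (N - d) * 2 ^ p + (d - 2) * N ^ p"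
proof -
  obtain q where q: "p = Suc q" "1 \<le> q" using assms(3) by (cases p) auto
  have "(2::int) ^ q < N ^ q" using assms q by (intro power_strict_mono) auto
  then have "0 < (N - d) * (d - 2) * (N ^ q - 2 ^ q)" using assms by simp
  with power_secant_step[OF power_secant_le[of d N q]] q assms show ?thesis by fastforce
qed

text \<open>The summed secant bounds depend only on the sum of \<open>d\<close> and increase with
  it; \<open>4 * N\<close> is the sum of two values \<open>N\<close> and \<open>N\<close> values 2.
  Equality puts every value at an end of the secant and makes the sum exactly
  \<open>4 * N\<close>.\<close>

lemma sum_power_le_two_large:
  fixes d :: "'a \<Rightarrow> nat"
  assumes fin: "finite V" and card: "card V = N + 2" and N: "2 < N" and p: "2 \<le> p"
    and d: "\<And>v. v \<in> V \<Longrightarrow> 2 \<le> d v \<and> d v \<le> N" and s: "sum d V \<le> 4 * N"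
  shows "(\<Sum>v\<in>V. d v ^ p) \<le> 2 * N ^ p + N * 2 ^ p"
    and "(\<Sum>v\<in>V. d v ^ p) = 2 * N ^ p + N * 2 ^ p \<Longrightarrow>
      (\<forall>v\<in>V. d v = 2 \<or> d v = N) \<and> card {v\<in>V. d v = N} = 2"
proof -
  define M where "M = int N"
  let ?D = "\<lambda>v. int (d v)"
  define S where "S = (\<Sum>v\<in>V. ?D v)"
  let ?f = "\<lambda>v. (M - 2) * ?D v ^ p" and ?g = "\<lambda>v. (M - ?D v) * 2 ^ p + (?D v - 2) * M ^ p"
  have S: "S \<le> 4 * M" using s unfolding S_def M_def by (simp flip: of_nat_sum)
  have fg: "?f v \<le> ?g v" if "v \<in> V" for v
    using d[OF that] p by (intro power_secant_le) (auto simp: M_def)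
  have M2: "2 < M" using N by (simp add: M_def)
  have Mp: "2 ^ p < M ^ p" using M2 p by (intro power_strict_mono) auto
  have cV: "int (card V) = M + 2" using card by (simp add: M_def)
  have "sum ?g V = ((M + 2) * M - S) * 2 ^ p + (S - 2 * (M + 2)) * M ^ p"
    using cV by (simp add: sum.distrib sum_subtractf S_def flip: sum_distrib_right)
  \<comment> \<open>The target appears minus a slack that is nonnegative by
    \<open>S \<le> 4 * M\<close>; equality in the end forces the slack to vanish.\<close>
  also have "\<dots> = (M - 2) * (2 * M ^ p + M * 2 ^ p) - (4 * M - S) * (M ^ p - 2 ^ p)"
    by (simp add: algebra_simps)
  finally have g: "sum ?g V = (M - 2) * (2 * M ^ p + M * 2 ^ p) - (4 * M - S) * (M ^ p - 2 ^ p)" .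
  have f: "sum ?f V = (M - 2) * int (\<Sum>v\<in>V. d v ^ p)" by (simp add: sum_distrib_left)
  have R: "2 * M ^ p + M * 2 ^ p = int (2 * N ^ p + N * 2 ^ p)" by (simp add: M_def)
  have fle: "sum ?f V \<le> sum ?g V" by (intro sum_mono fg)
  have nn: "0 \<le> (4 * M - S) * (M ^ p - 2 ^ p)" using S Mp by simp
  have "(M - 2) * int (\<Sum>v\<in>V. d v ^ p) \<le> (M - 2) * int (2 * N ^ p + N * 2 ^ p)"
    using fle nn unfolding f g R by linarith
  then show "(\<Sum>v\<in>V. d v ^ p) \<le> 2 * N ^ p + N * 2 ^ p" using M2
    by (simp only: mult_le_cancel_left_pos of_nat_le_iff)
  assume eq: "(\<Sum>v\<in>V. d v ^ p) = 2 * N ^ p + N * 2 ^ p"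
  have "(4 * M - S) * (M ^ p - 2 ^ p) = 0" and fgeq: "sum ?f V = sum ?g V"
    using fle nn unfolding f g R eq by linarith+
  then have S4: "S = 4 * M" using Mp by simp
  have all: "d v = 2 \<or> d v = N" if "v \<in> V" for v
  proof (rule ccontr)
    assume "\<not> ?thesis"
    then have "?f v < ?g v" using d[OF that] p by (intro power_secant_less) (auto simp: M_def)
    then have "sum ?f V < sum ?g V" using fg that fin by (intro sum_strict_mono_ex1) auto
    with fgeq show False by simp
  qed
  \<comment> \<open>The excess over 2 is \<open>M - 2\<close> at a value \<open>N\<close> and 0
    elsewhere, so the total excess \<open>2 * (M - 2)\<close> counts the values
    \<open>N\<close>.\<close>
  have "S - 2 * (M + 2) = (\<Sum>v\<in>V. ?D v - 2)" using cV by (simp add: S_def sum_subtractf)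
  also have "\<dots> = (\<Sum>v\<in>V. if d v = N then M - 2 else 0)"
    by (intro sum.cong refl) (use all in \<open>auto simp: M_def\<close>)
  also have "\<dots> = int (card {v\<in>V. d v = N}) * (M - 2)"
    using fin by (simp add: sum.If_cases Int_def)
  finally have "int (card {v\<in>V. d v = N}) * (M - 2) = 2 * (M - 2)" using S4 by simp
  then have "card {v\<in>V. d v = N} = 2" using M2 by (simp only: mult_cancel_right) auto
  with all show "(\<forall>v\<in>V. d v = 2 \<or> d v = N) \<and> card {v\<in>V. d v = N} = 2" by blast
qed

subsection \<open>Minimal connectivity\<close>

lemma pair_graphD:
  assumes "pair_graph G"
  shows "finite (pverts G)" "parcs G \<subseteq> pverts G \<times> pverts G" "sym (parcs G)" "irrefl (parcs G)"
proof -
  interpret pair_graph G by fact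
  show "finite (pverts G)" by (rule pair_finite_verts)
  show "parcs G \<subseteq> pverts G \<times> pverts G" using wellformed' by auto
  show "sym (parcs G)" using arcs_symmetric by (auto simp: sym_def)
  show "irrefl (parcs G)" using no_loops' by (auto simp: irrefl_def)
qed

lemma out_degree_conv_Image: "out_degree (with_proj G) v = card (parcs G `` {v})"
proof -
  have "out_arcs (with_proj G) v = Pair v ` (parcs G `` {v})" by (auto simp: out_arcs_def)
  then show ?thesis by (simp add: out_degree_def card_image inj_on_def)
qed

section \<open>Connectivity as reachability along arcs\<close>

text \<open>The two closures differ only in the reflexive pairs outside \<open>V\<close>.\<close>

lemma rtrancl_on_eq_rtrancl:
  assumes "R \<subseteq> V \<times> V" "u \<in> V"
  shows "(u,v) \<in> rtrancl_on V R \<longleftrightarrow> (u,v) \<in> R\<^sup>*"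
proof
  show "(u,v) \<in> R\<^sup>*" if "(u,v) \<in> rtrancl_on V R"
    using that by induction auto
  show "(u,v) \<in> rtrancl_on V R" if "(u,v) \<in> R\<^sup>*"
    using that by induction (use assms in \<open>auto intro: rtrancl_on_into_rtrancl_on\<close>)
qed

text \<open>\<open>connected\<close> refers to the symmetric closure of the arcs, which adds nothing
  to symmetric arcs.\<close>

lemma connected_iff_rtrancl:
  assumes "sym (arcs_ends H)" "arcs_ends H \<subseteq> verts H \<times> verts H"
  shows "connected H \<longleftrightarrow> verts H \<noteq> {} \<and> (\<forall>u\<in>verts H. \<forall>v\<in>verts H. (u,v) \<in> (arcs_ends H)\<^sup>*)"
proof -
  have "symcl (arcs_ends H) = arcs_ends H" using assms(1) by (auto simp: symcl_def sym_def)
  then show ?thesis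
    using rtrancl_on_eq_rtrancl[OF assms(2)] by (auto simp: connected_conv)
qed

lemma connected_del_edges_iff:
  assumes "pair_graph G"
  shows "connected (with_proj (del_edges G F)) \<longleftrightarrow>
    pverts G \<noteq> {} \<and> (\<forall>u\<in>pverts G. \<forall>v\<in>pverts G. (u,v) \<in> {(x,y) \<in> parcs G. {x,y} \<notin> F}\<^sup>*)"
  using pair_graphD[OF assms]
  by (subst connected_iff_rtrancl) (auto simp: del_edges_def sym_def insert_commute)

lemma connected_induce_iff:
  assumes "pair_graph G" "W \<subseteq> pverts G"
  shows "connected (induce_subgraph (with_proj G) W) \<longleftrightarrow>
    W \<noteq> {} \<and> (\<forall>u\<in>W. \<forall>v\<in>W. (u,v) \<in> (parcs G \<inter> W \<times> W)\<^sup>*)"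
proof -
  have "arcs_ends (induce_subgraph (with_proj G) W) = parcs G \<inter> W \<times> W"
    by (auto simp: arcs_ends_def arc_to_ends_def)
  then show ?thesis using pair_graphD[OF assms(1)]
    by (subst connected_iff_rtrancl) (auto simp: sym_def)
qed

lemma pair_graph_del_edges:
  assumes "pair_graph G"
  shows "pair_graph (del_edges G F)"
proof -
  interpret pair_graph G by fact
  have "finite (parcs (del_edges G F))"
    by (rule finite_subset[OF _ pair_finite_arcs]) (auto simp: del_edges_def)
  then show ?thesis
    by unfold_locales (auto simp: del_edges_def symmetric_def sym_def insert_commute wellformed'
      no_loops' arcs_symmetric)
qed

lemma del_edges_del_edges: "del_edges (del_edges G F) F' = del_edges G (F \<union> F')"
  by (auto simp: del_edges_def)

section \<open>Deleting a chord preserves connectivity\<close>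

lemma successively_imp_rtrancl:
  assumes "successively (\<lambda>x y. (x,y) \<in> R) (u # xs @ [v])"
  shows "(u,v) \<in> R\<^sup>*"
  using assms by (induction xs arbitrary: u) (auto intro: converse_rtrancl_into_rtrancl)

text \<open>A simple path with an inner vertex cannot use the edge between its ends, so it survives
  the deletion of that edge.\<close>

lemma path_avoids_chord:
  assumes "successively (\<lambda>x y. (x,y) \<in> E) (u # xs @ [v])" "distinct (u # xs @ [v])" "xs \<noteq> []"
    and "{(x,y) \<in> E. {x,y} \<noteq> {u,v} \<and> {x,y} \<subseteq> insert u (insert v (set xs))} \<subseteq> R"
  shows "(u,v) \<in> R\<^sup>*"
proof (rule successively_imp_rtrancl)
  let ?l = "u # xs @ [v]"
  show "successively (\<lambda>x y. (x,y) \<in> R) ?l"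
    unfolding successively_conv_nth
  proof (intro allI impI)
    fix i assume i: "Suc i < length ?l"
    have E: "(?l ! i, ?l ! Suc i) \<in> E" using assms(1) i unfolding successively_conv_nth by blast
    have mem: "?l ! i \<in> set ?l" "?l ! Suc i \<in> set ?l" using i nth_mem[of i ?l] nth_mem[of "Suc i" ?l] by auto
    \<comment> \<open>By distinctness the ends occur only at indices 0 and
      \<open>Suc (length xs)\<close>, which are consecutive only if \<open>xs\<close> is
      empty.\<close>
    have "{?l ! i, ?l ! Suc i} \<noteq> {u,v}"
    proof
      assume eq: "{?l ! i, ?l ! Suc i} = {u,v}"
      have uv: "u = ?l ! 0" "v = ?l ! (Suc (length xs))" by (auto simp: nth_append)
      have inj: "?l ! a = ?l ! b \<longleftrightarrow> a = b" if "a < length ?l" "b < length ?l" for a b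
        using nth_eq_iff_index_eq[OF assms(2)] that by blast
      have "u = ?l ! i \<or> u = ?l ! Suc i" "v = ?l ! i \<or> v = ?l ! Suc i" using eq by auto
      then have "0 = i" "Suc (length xs) = Suc i \<or> Suc (length xs) = i"
        using inj[of 0 i] inj[of 0 "Suc i"] inj[of "Suc (length xs)" i] inj[of "Suc (length xs)" "Suc i"] i uv
        by auto
      then show False using assms(3) by auto
    qed
    with E mem assms(4) show "(?l ! i, ?l ! Suc i) \<in> R" by auto
  qed
qed

text \<open>
  Removing a single vertex or edge spares one of the two arcs \<open>xs\<close>, \<open>ys\<close> of the cycle; the
  predicate \<open>Q\<close> says which arcs are spared.
\<close>

lemma chord_ends_connected:
  assumes cyc: "successively (\<lambda>x y. (x,y) \<in> E) (u # xs @ v # ys @ [u])"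
      "distinct (u # xs @ v # ys)" "xs \<noteq> []" "ys \<noteq> []"
    and "sym R"
    and R: "\<And>zs. zs = xs \<or> zs = ys \<Longrightarrow> Q zs \<Longrightarrow>
      {(x,y) \<in> E. {x,y} \<noteq> {u,v} \<and> {x,y} \<subseteq> insert u (insert v (set zs))} \<subseteq> R"
    and Q: "Q xs \<or> Q ys"
  shows "(u,v) \<in> R\<^sup>* \<and> (v,u) \<in> R\<^sup>*"
proof -
  have sR: "sym (R\<^sup>*)" using \<open>sym R\<close> by (rule sym_rtrancl)
  have "successively (\<lambda>x y. (x,y) \<in> E) ((u # xs @ [v]) @ ys @ [u])"
    "successively (\<lambda>x y. (x,y) \<in> E) ((u # xs) @ (v # ys @ [u]))" using cyc(1) by simp_all
  then have p: "successively (\<lambda>x y. (x,y) \<in> E) (u # xs @ [v])"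
     "successively (\<lambda>x y. (x,y) \<in> E) (v # ys @ [u])"
    by (auto simp only: successively_append_iff)
  have "(u,v) \<in> R\<^sup>* \<or> (v,u) \<in> R\<^sup>*"
    using Q
  proof
    assume "Q xs"
    then show ?thesis using p(1) cyc R[of xs] path_avoids_chord[of E u xs v R] by auto
  next
    assume "Q ys"
    then show ?thesis using p(2) cyc R[of ys] path_avoids_chord[of E v ys u R]
      by (auto simp: insert_commute)
  qed
  then show ?thesis using sR by (auto dest: symD)
qed

text \<open>The chord can be deleted without losing 2-edge-connectivity, against minimality: after
  the loss of at most one further edge its ends are still joined along one arc of the cycle, and
  walks through the chord are rerouted there.\<close>

lemma minimally_edge_connected_not_chorded:
  assumes G: "pair_graph G" and min: "minimally_edge_connected 2 G"
  shows "\<not> chorded_cycle (parcs G)"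
proof
  assume "chorded_cycle (parcs G)"
  then obtain u v xs ys where uv: "(u,v) \<in> parcs G" and cyc:
    "successively (\<lambda>x y. (x,y) \<in> parcs G) (u # xs @ v # ys @ [u])"
      "distinct (u # xs @ v # ys)" "xs \<noteq> []" "ys \<noteq> []"
    unfolding chorded_cycle_def by blast
  note g = pair_graphD[OF G]
  let ?e = "{u,v}"
  have "edge_connected 2 (del_edges G {?e})"
    unfolding edge_connected_def del_edges_del_edges connected_del_edges_iff[OF G]
  proof (intro allI impI)
    fix F assume F: "F \<subseteq> uedges (del_edges G {?e}) \<and> finite F \<and> card F < 2"
    let ?R = "{(x,y) \<in> parcs G. {x,y} \<notin> F}" and ?R' = "{(x,y) \<in> parcs G. {x,y} \<notin> {?e} \<union> F}"
    have "F \<subseteq> uedges G" using F by (auto simp: uedges_def del_edges_def)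
    then have c: "pverts G \<noteq> {}" "\<And>a b. a \<in> pverts G \<Longrightarrow> b \<in> pverts G \<Longrightarrow> (a,b) \<in> ?R\<^sup>*"
      using min F unfolding minimally_edge_connected_def edge_connected_def connected_del_edges_iff[OF G]
      by blast+
    define Q where "Q zs \<longleftrightarrow> (\<forall>f\<in>F. \<not> f \<subseteq> insert u (insert v (set zs)))" for zs
    \<comment> \<open>\<open>F\<close> has at most one edge. If it met both vertex sets it would lie
      in their intersection \<open>{u,v}\<close>, but the chord is no longer an edge.\<close>
    have "Q xs \<or> Q ys"
    proof (rule ccontr)
      assume "\<not> ?thesis"
      then obtain f f' where f: "f \<in> F" "f' \<in> F" "f \<subseteq> insert u (insert v (set xs))" "f' \<subseteq> insert u (insert v (set ys))"
        unfolding Q_def by blast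
      have "f' = f" using F f(1,2) card_le_Suc0_iff_eq[of F] by (auto simp: numeral_2_eq_2 less_Suc_eq_le)
      then have "f \<subseteq> {u,v}" using f cyc(2) by auto
      moreover have "f \<in> uedges (del_edges G {?e})" using F f(1) by blast
      then obtain a b where ab: "f = {a,b}" "(a,b) \<in> parcs G" "f \<noteq> {u,v}"
        by (auto simp: uedges_def del_edges_def)
      moreover have "a \<noteq> b" using ab g(4) by (auto simp: irrefl_def)
      ultimately show False by auto
    qed
    then have st: "(u,v) \<in> ?R'\<^sup>* \<and> (v,u) \<in> ?R'\<^sup>*"
      by (intro chord_ends_connected[OF cyc, where Q = Q])
        (use g(3) in \<open>auto simp: sym_def insert_commute Q_def\<close>)
    have "?R \<subseteq> ?R'\<^sup>*"
    proof clarify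
      fix x y assume "(x,y) \<in> parcs G" "{x,y} \<notin> F"
      then show "(x,y) \<in> ?R'\<^sup>*" using st by (cases "{x,y} = {u,v}") (auto simp: doubleton_eq_iff)
    qed
    then have "?R\<^sup>* \<subseteq> ?R'\<^sup>*" by (rule rtrancl_subset_rtrancl)
    then show "pverts G \<noteq> {} \<and> (\<forall>a\<in>pverts G. \<forall>b\<in>pverts G. (a,b) \<in> ?R'\<^sup>*)" using c by blast
  qed
  then show False using min uv unfolding minimally_edge_connected_def uedges_def by force
qed

text \<open>The same rerouting with a deleted vertex in place of an edge: it lies on at most one of
  the two arcs, and if it is an end of the chord, no remaining walk uses the chord.\<close>

lemma minimally_vertex_connected_not_chorded:
  assumes G: "pair_graph G" and min: "minimally_vertex_connected 2 G"
  shows "\<not> chorded_cycle (parcs G)"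
proof
  assume "chorded_cycle (parcs G)"
  then obtain u v xs ys where uv: "(u,v) \<in> parcs G" and cyc:
    "successively (\<lambda>x y. (x,y) \<in> parcs G) (u # xs @ v # ys @ [u])"
      "distinct (u # xs @ v # ys)" "xs \<noteq> []" "ys \<noteq> []"
    unfolding chorded_cycle_def by blast
  note g = pair_graphD[OF G]
  let ?e = "{u,v}"
  let ?G = "del_edges G {?e}"
  have V: "pverts ?G = pverts G" by (simp add: del_edges_def)
  have "vertex_connected 2 ?G"
    unfolding vertex_connected_def
  proof (intro allI impI)
    fix S assume S: "S \<subseteq> pverts ?G \<and> finite S \<and> card S < 2"
    let ?W = "pverts G - S"
    let ?R = "parcs G \<inter> ?W \<times> ?W" and ?R' = "parcs ?G \<inter> ?W \<times> ?W"
    have "connected (induce_subgraph (with_proj G) ?W)"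
      using min S V unfolding minimally_vertex_connected_def vertex_connected_def by auto
    then have c: "?W \<noteq> {}" "\<And>a b. a \<in> ?W \<Longrightarrow> b \<in> ?W \<Longrightarrow> (a,b) \<in> ?R\<^sup>*"
      using connected_induce_iff[OF G, of ?W] by blast+
    have "?R \<subseteq> ?R'\<^sup>*"
    proof (cases "u \<in> S \<or> v \<in> S")
      case True
      then have "?R \<subseteq> ?R'" by (auto simp: del_edges_def doubleton_eq_iff)
      then show ?thesis by auto
    next
      case False
      define Q where "Q zs \<longleftrightarrow> set zs \<inter> S = {}" for zs
      have "Q xs \<or> Q ys"
      proof (rule ccontr)
        assume "\<not> ?thesis"
        then obtain a b where f: "a \<in> S" "b \<in> S" "a \<in> set xs" "b \<in> set ys"
          unfolding Q_def by blast
        have "a = b" using S f(1,2) card_le_Suc0_iff_eq[of S] by (auto simp: numeral_2_eq_2 less_Suc_eq_le)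
        then show False using f cyc(2) by auto
      qed
      then have st: "(u,v) \<in> ?R'\<^sup>* \<and> (v,u) \<in> ?R'\<^sup>*"
        by (intro chord_ends_connected[OF cyc, where Q = Q])
          (use g(2,3) False in \<open>auto simp: sym_def insert_commute Q_def del_edges_def\<close>)
      show ?thesis
      proof clarify
        fix x y assume "(x,y) \<in> parcs G" "x \<in> pverts G" "y \<in> pverts G" "x \<notin> S" "y \<notin> S"
        then show "(x,y) \<in> ?R'\<^sup>*" using st
          by (cases "{x,y} = {u,v}") (auto simp: doubleton_eq_iff del_edges_def)
      qed
    qed
    then have "?R\<^sup>* \<subseteq> ?R'\<^sup>*" by (rule rtrancl_subset_rtrancl)
    then have "?W \<noteq> {} \<and> (\<forall>a\<in>?W. \<forall>b\<in>?W. (a,b) \<in> ?R'\<^sup>*)" using c by blast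
    then show "connected (induce_subgraph (with_proj ?G) (pverts ?G - S))"
      using connected_induce_iff[OF pair_graph_del_edges[OF G], of ?W "{?e}"] V by simp
  qed
  then show False using min uv unfolding minimally_vertex_connected_def uedges_def by force
qed

section \<open>Minimum degree\<close>

text \<open>Otherwise deleting the at most one edge at \<open>v\<close> isolates it from the other
  vertices.\<close>

lemma edge_connected_degree_ge_2:
  assumes G: "pair_graph G" and ec: "edge_connected 2 G" and n: "2 \<le> card (pverts G)" and v: "v \<in> pverts G"
  shows "2 \<le> card (parcs G `` {v})"
proof (rule ccontr)
  assume less: "\<not> ?thesis"
  note g = pair_graphD[OF G]
  let ?N = "parcs G `` {v}"
  let ?F = "(\<lambda>w. {v,w}) ` ?N"
  let ?R = "{(x,y) \<in> parcs G. {x,y} \<notin> ?F}"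
  have finN: "finite ?N" by (rule finite_subset[OF _ g(1)]) (use g(2) in auto)
  have "?F \<subseteq> uedges G" by (auto simp: uedges_def)
  moreover have "card ?F < 2" using card_image_le[OF finN, of "\<lambda>w. {v,w}"] less by linarith
  ultimately have conn: "\<And>a b. a \<in> pverts G \<Longrightarrow> b \<in> pverts G \<Longrightarrow> (a,b) \<in> ?R\<^sup>*"
    using ec finN unfolding edge_connected_def connected_del_edges_iff[OF G] by blast
  have "pverts G \<noteq> {v}" using n by auto
  then obtain w where w: "w \<in> pverts G" "w \<noteq> v" using v by blast
  from conn[OF v w(1)] show False by (cases rule: converse_rtranclE) (use w in auto)
qed

text \<open>Otherwise deleting the at most one neighbour isolates \<open>v\<close>; three vertices
  guarantee that another one is left.\<close>

lemma vertex_connected_degree_ge_2: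
  assumes G: "pair_graph G" and vc: "vertex_connected 2 G" and n: "3 \<le> card (pverts G)" and v: "v \<in> pverts G"
  shows "2 \<le> card (parcs G `` {v})"
proof (rule ccontr)
  assume less: "\<not> ?thesis"
  note g = pair_graphD[OF G]
  let ?N = "parcs G `` {v}"
  let ?W = "pverts G - ?N"
  have sub: "?N \<subseteq> pverts G" using g(2) by auto
  have finN: "finite ?N" by (rule finite_subset[OF sub g(1)])
  then have "connected (induce_subgraph (with_proj G) ?W)"
    using vc sub less unfolding vertex_connected_def by (meson not_less)
  then have conn: "\<And>a b. a \<in> ?W \<Longrightarrow> b \<in> ?W \<Longrightarrow> (a,b) \<in> (parcs G \<inter> ?W \<times> ?W)\<^sup>*"
    using connected_induce_iff[OF G, of ?W] by blast
  have vW: "v \<in> ?W" using v g(4) by (auto simp: irrefl_def)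
  have "2 \<le> card ?W" using less n card_Diff_subset[OF finN sub] by linarith
  then have "?W \<noteq> {v}" by auto
  then obtain w where w: "w \<in> ?W" "w \<noteq> v" using vW by blast
  from conn[OF vW w(1)] show False by (cases rule: converse_rtranclE) (use w in auto)
qed

subsection \<open>Extremal graphs\<close>

text \<open>Arcs are pairs, so the vertex map determines the arc map. The map starts at
  \<open>H\<close>, whose vertices are concrete numbers in the applications; the isomorphism is
  reversed at the end.\<close>

lemma graph_isoI:
  assumes H: "pair_wf_digraph H" and "inj_on f (pverts H)"
    and "pverts G = f ` pverts H" and "parcs G = map_prod f f ` parcs H"
  shows "graph_iso G H"
proof -
  let ?h = "\<lparr>iso_verts = f, iso_arcs = map_prod f f, iso_head = snd, iso_tail = fst\<rparr>"
  interpret pair_wf_digraph H by fact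
  have "parcs H \<subseteq> pverts H \<times> pverts H" using wellformed' by auto
  then have "inj_on (map_prod f f) (parcs H)"
    using map_prod_inj_on[OF assms(2,2)] inj_on_subset by blast
  then have "pre_digraph.digraph_isomorphism (with_proj H) ?h"
    using assms(2) wf_digraph_axioms by (auto simp: pre_digraph.digraph_isomorphism_def)
  moreover have "with_proj G = app_iso ?h (with_proj H)"
    using assms(3,4) by (simp add: app_iso_def with_proj_def)
  ultimately have "digraph_iso (with_proj H) (with_proj G)" unfolding digraph_iso_def by blast
  then show ?thesis using digraph_iso_swap[OF wf_digraph_axioms] by (simp add: graph_iso_def)
qed

text \<open>Gives the direction from isomorphism to equality in the extremal cases.\<close>

lemma degree_power_graph_iso:
  assumes "pair_graph G" "graph_iso G H"
  shows "degree_power p G = degree_power p H"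
proof -
  interpret pair_graph G by fact
  obtain f where f: "digraph_isomorphism f" and H: "with_proj H = app_iso f (with_proj G)"
    using assms(2) unfolding graph_iso_def digraph_iso_def by blast
  have V: "pverts H = iso_verts f ` pverts G"
    using arg_cong[OF H, of verts] by simp
  have "degree_power p H = (\<Sum>v\<in>pverts G. out_degree (with_proj H) (iso_verts f v) ^ p)"
    unfolding degree_power_def V
    using digraph_isomorphism_inj_on_verts[OF f] by (simp add: sum.reindex)
  also have "\<dots> = degree_power p G"
    unfolding degree_power_def H using out_degree_app_iso_eq[OF f] by simp
  finally show ?thesis by simp
qed

section \<open>The extremal graph \<open>K_{2,n-2}\<close>\<close>

lemma pair_wf_digraph_bipartite_graph: "pair_wf_digraph (bipartite_graph a b)"
  by unfold_locales (auto simp: bipartite_graph_def)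

lemma degree_power_bipartite_graph:
  "degree_power p (bipartite_graph a b) = a * b ^ p + b * a ^ p"
proof -
  let ?E = "parcs (bipartite_graph a b)"
  have 1: "card (?E `` {v}) = b" if "v \<in> {..<a}" for v
  proof -
    have "?E `` {v} = {a..<a+b}" using that by (auto simp: bipartite_graph_def)
    then show ?thesis by simp
  qed
  have 2: "card (?E `` {v}) = a" if "v \<in> {a..<a+b}" for v
  proof -
    have "?E `` {v} = {..<a}" using that by (auto simp: bipartite_graph_def)
    then show ?thesis by simp
  qed
  have V: "pverts (bipartite_graph a b) = {..<a} \<union> {a..<a+b}" by (auto simp: bipartite_graph_def)
  have "degree_power p (bipartite_graph a b)
      = (\<Sum>v<a. card (?E `` {v}) ^ p) + (\<Sum>v=a..<a+b. card (?E `` {v}) ^ p)"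
    unfolding degree_power_def out_degree_conv_Image V by (rule sum.union_disjoint) auto
  also have "(\<Sum>v<a. card (?E `` {v}) ^ p) = (\<Sum>v<a. b ^ p)"
    by (intro sum.cong) (simp_all only: 1)
  also have "(\<Sum>v=a..<a+b. card (?E `` {v}) ^ p) = (\<Sum>v=a..<a+b. a ^ p)"
    by (intro sum.cong) (simp_all only: 2)
  finally show ?thesis by simp
qed

text \<open>By counting, \<open>u\<close> and \<open>v\<close> are joined to all other vertices.
  This exhausts the degree 2 of each of those, leaving no further edges.\<close>

lemma graph_iso_bipartite_graph_2:
  assumes G: "pair_graph G" and n: "card (pverts G) = n" "2 \<le> n"
    and uv: "u \<in> pverts G" "v \<in> pverts G" "u \<noteq> v" "(u,v) \<notin> parcs G"
    and deg: "card (parcs G `` {u}) = n - 2" "card (parcs G `` {v}) = n - 2"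
      "\<And>w. w \<in> pverts G - {u,v} \<Longrightarrow> card (parcs G `` {w}) = 2"
  shows "graph_iso G (bipartite_graph 2 (n - 2))"
proof -
  note g = pair_graphD[OF G]
  let ?W = "pverts G - {u,v}"
  have cW: "card ?W = n - 2" using n uv g(1) by (subst card_Diff_subset) auto
  have "(v,u) \<notin> parcs G" using uv g(3) by (auto simp: sym_def)
  then have "parcs G `` {u} \<subseteq> ?W" "parcs G `` {v} \<subseteq> ?W" using g uv by (auto simp: irrefl_def)
  then have nu: "parcs G `` {u} = ?W" "parcs G `` {v} = ?W"
    using g(1) deg(1,2) cW by (simp_all add: card_subset_eq)
  have nw: "parcs G `` {w} = {u,v}" if w: "w \<in> ?W" for w
  proof -
    have "(u,w) \<in> parcs G" "(v,w) \<in> parcs G" using nu w by blast+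
    then have "{u,v} \<subseteq> parcs G `` {w}" using g(3) by (auto simp: sym_def)
    moreover have "finite (parcs G `` {w})" by (rule finite_subset[OF _ g(1)]) (use g(2) in auto)
    ultimately show ?thesis using deg(3)[OF w] uv(3) card_subset_eq[of "parcs G `` {w}" "{u,v}"] by simp
  qed
  have E: "parcs G = {u,v} \<times> ?W \<union> ?W \<times> {u,v}" (is "_ = ?R")
  proof (rule set_eqI, clarify)
    fix x y
    have "(x,y) \<in> parcs G \<longleftrightarrow> x \<in> pverts G \<and> y \<in> parcs G `` {x}" using g(2) by auto
    also have "\<dots> \<longleftrightarrow> (x,y) \<in> ?R"
      using nu nw[of x] uv by (cases "x = u"; cases "x = v") auto
    finally show "(x,y) \<in> parcs G \<longleftrightarrow> (x,y) \<in> ?R" .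
  qed
  have "card {2..<n} = card ?W" using cW by simp
  then obtain h where h: "bij_betw h {2..<n} ?W"
    using g(1) finite_same_card_bij[of "{2..<n}" ?W] by blast
  then have hW: "h ` {2..<n} = ?W" and hi: "inj_on h {2..<n}" by (auto simp: bij_betw_def)
  define f where "f i = (if i = 0 then u else if i = 1 then v else h i)" for i
  have two: "{..<2} = {0, 1::nat}" by auto
  have V: "{..<n} = {0,1} \<union> {2..<n}" using n(2) by auto
  have f2: "f ` {2..<n} = ?W" using hW by (auto simp: f_def)
  have f01: "f ` {0,1} = {u,v}" by (auto simp: f_def)
  have "inj_on f {2..<n}" using hi by (auto simp: f_def inj_on_def)
  then have "inj_on f {..<n}" unfolding V using uv f2 f01
    by (subst inj_on_Un) (auto simp: f_def)
  moreover have "pverts G = f ` {..<n}" unfolding V image_Un f01 f2 using uv by auto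
  moreover have "parcs G = map_prod f f ` ({0,1} \<times> {2..<n} \<union> {2..<n} \<times> {0,1})"
    unfolding E image_Un map_prod_surj_on[OF f01 f2] map_prod_surj_on[OF f2 f01] ..
  moreover have "bipartite_graph 2 (n - 2) =
      \<lparr> pverts = {..<n}, parcs = {0,1} \<times> {2..<n} \<union> {2..<n} \<times> {0,1} \<rparr>"
    using n(2) by (simp only: bipartite_graph_def two le_add_diff_inverse)
  ultimately show ?thesis
    by (intro graph_isoI[OF pair_wf_digraph_bipartite_graph, of f]) simp_all
qed

text \<open>Excludes the other way to realise the extremal degrees. Inclusion-exclusion yields at
  least \<open>n - 4\<close> common neighbours of \<open>u\<close> and \<open>v\<close>; two of
  them, \<open>x\<close> and \<open>y\<close>, give the cycle \<open>u, x, v, y\<close> with chord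
  \<open>uv\<close>. A single common neighbour is possible only for \<open>n = 5\<close>, and then
  \<open>u, a, b, v, x\<close> is a cycle with the same chord.\<close>

lemma adjacent_large_vertices_chorded_cycle:
  assumes G: "pair_graph G" and n: "card (pverts G) = n" "5 \<le> n"
    and uv: "(u,v) \<in> parcs G"
    and deg: "card (parcs G `` {u}) = n - 2" "card (parcs G `` {v}) = n - 2"
      "\<And>w. w \<in> pverts G - {u,v} \<Longrightarrow> card (parcs G `` {w}) = 2"
  shows "chorded_cycle (parcs G)"
proof -
  note g = pair_graphD[OF G]
  have uvV: "u \<in> pverts G" "v \<in> pverts G" "u \<noteq> v" "(v,u) \<in> parcs G"
    using g uv by (auto simp: irrefl_def sym_def)
  have fin: "finite (parcs G `` {x})" for x by (rule finite_subset[OF _ g(1)]) (use g(2) in auto)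
  let ?W = "pverts G - {u,v}"
  have cW: "card ?W = n - 2" using n uvV g(1) by (subst card_Diff_subset) auto
  define A where "A = parcs G `` {u} - {v}"
  define B where "B = parcs G `` {v} - {u}"
  have AB: "A \<subseteq> ?W" "B \<subseteq> ?W" using g by (auto simp: A_def B_def irrefl_def)
  have finAB: "finite A" "finite B" using fin by (auto simp: A_def B_def)
  have cAB: "card A = n - 3" "card B = n - 3"
    using deg uv uvV fin by (auto simp: A_def B_def card_Diff_singleton)
  have "card (A \<union> B) \<le> n - 2" using card_mono[of ?W "A \<union> B"] AB g(1) cW by auto
  moreover have "card A + card B = card (A \<union> B) + card (A \<inter> B)" using finAB by (rule card_Un_Int)
  ultimately have cI: "n - 4 \<le> card (A \<inter> B)" using cAB n(2) by linarith
  show ?thesis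
  proof (cases "2 \<le> card (A \<inter> B)")
    case True
    then obtain x y where xy: "x \<in> A \<inter> B" "y \<in> A \<inter> B" "x \<noteq> y"
      by (metis card_2_iff card_Ex_subset insert_subset)
    then show ?thesis using uv uvV g(3) AB
      by (intro chorded_cycleI[of u v _ "[x]" "[y]"]) (auto simp: A_def B_def sym_def)
  next
    case False
    then have n5: "n = 5" and "card (A \<inter> B) = 1" using cI n(2) by linarith+
    then obtain x where x: "A \<inter> B = {x}" by (auto simp: card_1_singleton_iff)
    have "card (A - {x}) = 1" "card (B - {x}) = 1" using cAB n5 x finAB by (auto simp: card_Diff_singleton_if)
    then obtain a b where a: "A - {x} = {a}" and b: "B - {x} = {b}" by (auto simp: card_1_singleton_iff)
    have ab: "A = {x,a}" "B = {x,b}" "x \<noteq> a" "x \<noteq> b" using a b x by auto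
    then have anb: "a \<noteq> b" using x by auto
    have "card {x,a,b} = card ?W" using ab anb cW n5 by simp
    then have W: "{x,a,b} = ?W" using AB ab g(1) by (intro card_subset_eq) auto
    have mem: "x \<in> ?W" "a \<in> ?W" "b \<in> ?W" using W by blast+
    have V: "z \<in> {u,v,x,a,b}" if "z \<in> pverts G" for z using W that by blast
    have adj: "(u,x) \<in> parcs G" "(v,x) \<in> parcs G" "(u,a) \<in> parcs G" "(v,b) \<in> parcs G"
      using ab(1,2) unfolding A_def B_def by blast+
    have "b \<notin> A" using ab anb by auto
    then have "(u,b) \<notin> parcs G" using mem(3) unfolding A_def by blast
    then have bu: "(b,u) \<notin> parcs G" using g(3) by (auto simp: sym_def)
    have "{u,v} \<subseteq> parcs G `` {x}" using adj g(3) by (auto simp: sym_def)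
    then have "parcs G `` {x} = {u,v}"
      using deg(3)[OF mem(1)] uvV(3) fin card_subset_eq[of "parcs G `` {x}" "{u,v}"] by simp
    then have bx: "(b,x) \<notin> parcs G" using g(3) mem(3) by (auto simp: sym_def)
    \<comment> \<open>Among the five vertices, \<open>u\<close> is not adjacent to \<open>b\<close>,
      and \<open>x\<close> has its degree used up by \<open>u\<close> and \<open>v\<close>; degree 2
      then forces the edge \<open>ba\<close>.\<close>
    have "parcs G `` {b} \<subseteq> {v,a}"
    proof
      fix z assume z: "z \<in> parcs G `` {b}"
      then have "z \<in> {u,v,x,a,b}" "z \<noteq> b" using V g(2,4) by (auto simp: irrefl_def)
      then show "z \<in> {v,a}" using z bu bx by auto
    qed
    moreover have "card (parcs G `` {b}) = 2" by (rule deg(3)[OF mem(3)])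
    moreover have "card {v,a} = 2" using mem(2) by auto
    ultimately have "parcs G `` {b} = {v,a}" by (intro card_subset_eq) auto
    then have "(b,a) \<in> parcs G" "(a,b) \<in> parcs G" using g(3) by (auto simp: sym_def)
    moreover have "distinct [u,a,b,v,x]" using mem ab anb uvV by auto
    ultimately show ?thesis using uv uvV adj g(3)
      by (intro chorded_cycleI[of u v _ "[a,b]" "[x]"]) (auto simp: sym_def)
  qed
qed

text \<open>Posa's bound makes the degree sum at most \<open>4 * (n - 2)\<close>, as the convexity
  estimate with \<open>N = n - 2\<close> requires. For \<open>n = 4\<close> the secant degenerates,
  since \<open>N = 2\<close>, and all degrees equal 2.\<close>

lemma degree_power_le_bipartite:
  assumes G: "pair_graph G" and n: "card (pverts G) = n" "4 \<le> n" and p: "2 \<le> p"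
    and nc: "\<not> chorded_cycle (parcs G)"
    and deg: "\<And>v. v \<in> pverts G \<Longrightarrow> 2 \<le> card (parcs G `` {v}) \<and> card (parcs G `` {v}) \<le> n - 2"
  shows "degree_power p G \<le> 2 * (n - 2) ^ p + (n - 2) * 2 ^ p"
    and "degree_power p G = 2 * (n - 2) ^ p + (n - 2) * 2 ^ p \<Longrightarrow>
      graph_iso G (bipartite_graph 2 (n - 2))"
proof -
  note g = pair_graphD[OF G]
  let ?V = "pverts G" and ?d = "\<lambda>v. card (parcs G `` {v})"
  have fin: "finite (parcs G `` {x})" for x by (rule finite_subset[OF _ g(1)]) (use g(2) in auto)
  have dp: "degree_power p G = (\<Sum>v\<in>?V. ?d v ^ p)" by (simp add: degree_power_def out_degree_conv_Image)
  have "card (parcs G) + 8 \<le> 4 * n"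
    using Posa_chorded_cycle_bound[OF g(1) _ g(2-4) nc] n by simp
  then have s: "(\<Sum>v\<in>?V. ?d v) \<le> 4 * (n - 2)"
    using card_rel_eq_sum_degree[OF g(1,2)] by simp
  have "degree_power p G \<le> 2 * (n - 2) ^ p + (n - 2) * 2 ^ p \<and>
    (degree_power p G = 2 * (n - 2) ^ p + (n - 2) * 2 ^ p \<longrightarrow> graph_iso G (bipartite_graph 2 (n - 2)))"
  proof (cases "n = 4")
    case True
    have d2: "?d v = 2" if "v \<in> ?V" for v using deg[OF that] True by simp
    have "(\<Sum>v\<in>?V. ?d v ^ p) = (\<Sum>v\<in>?V. 2 ^ p)" by (rule sum.cong) (simp_all add: d2)
    then have "degree_power p G = 4 * 2 ^ p" using dp n True by simp
    \<comment> \<open>Here the target is the 4-cycle: \<open>u\<close> and its two neighbours leave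
      a fourth vertex \<open>v\<close> not adjacent to \<open>u\<close>, and the degrees
      \<open>n - 2\<close> and 2 coincide.\<close>
    moreover have "graph_iso G (bipartite_graph 2 (n - 2))"
    proof -
      have "?V \<noteq> {}" using n by auto
      then obtain u where u: "u \<in> ?V" by blast
      have "insert u (parcs G `` {u}) \<subseteq> ?V" "u \<notin> parcs G `` {u}"
        using u g by (auto simp: irrefl_def)
      moreover have "card (insert u (parcs G `` {u})) = 3"
        using calculation(2) d2[OF u] fin by simp
      ultimately obtain v where "v \<in> ?V" "v \<notin> insert u (parcs G `` {u})"
        using n True by (metis numeral_eq_iff semiring_norm(88) subsetI subset_antisym)
      then show ?thesis using d2 u n True by (intro graph_iso_bipartite_graph_2[OF G n(1), of u v]) auto
    qed
    ultimately show ?thesis using True by simp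
  next
    case False
    then have N: "2 < n - 2" and n5: "5 \<le> n" using n by auto
    have cV: "card ?V = n - 2 + 2" using n by simp
    note * = sum_power_le_two_large[OF g(1) cV N p _ s, folded dp]
    show ?thesis
    proof (intro conjI impI)
      show "degree_power p G \<le> 2 * (n - 2) ^ p + (n - 2) * 2 ^ p" using deg by (rule *(1))
      assume "degree_power p G = 2 * (n - 2) ^ p + (n - 2) * 2 ^ p"
      from *(2)[OF _ this] deg have all: "\<And>v. v \<in> ?V \<Longrightarrow> ?d v = 2 \<or> ?d v = n - 2"
        and "card {v \<in> ?V. ?d v = n - 2} = 2" by blast+
      then obtain u v where uv: "{v \<in> ?V. ?d v = n - 2} = {u,v}" "u \<noteq> v" by (auto simp: card_2_iff)
      have m: "w \<in> {u,v} \<longleftrightarrow> w \<in> ?V \<and> ?d w = n - 2" for w unfolding uv(1)[symmetric] by blast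
      have uvV: "u \<in> ?V" "v \<in> ?V" "?d u = n - 2" "?d v = n - 2" using m[of u] m[of v] by auto
      have rest: "?d w = 2" if "w \<in> ?V - {u,v}" for w using all[of w] m[of w] that by blast
      have "(u,v) \<notin> parcs G"
        using adjacent_large_vertices_chorded_cycle[OF G n(1) n5 _ uvV(3,4) rest] nc by blast
      then show "graph_iso G (bipartite_graph 2 (n - 2))"
        using n by (intro graph_iso_bipartite_graph_2[OF G n(1) _ uvV(1,2) uv(2) _ uvV(3,4) rest]) auto
    qed
  qed
  then show "degree_power p G \<le> 2 * (n - 2) ^ p + (n - 2) * 2 ^ p"
    and "degree_power p G = 2 * (n - 2) ^ p + (n - 2) * 2 ^ p \<Longrightarrow>
      graph_iso G (bipartite_graph 2 (n - 2))" by blast+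
qed

section \<open>Graphs with a dominating vertex\<close>

text \<open>Lists partners consecutively, as the matching in \<open>friendship_graph\<close> does:
  enumerate the rest after removing \<open>x\<close> and \<open>m x\<close>, then append this
  pair.\<close>

lemma involution_enumeration:
  assumes "finite A" "\<And>x. x \<in> A \<Longrightarrow> m x \<in> A \<and> m x \<noteq> x \<and> m (m x) = x"
  shows "\<exists>k g. card A = 2 * k \<and> bij_betw g {..<2 * k} A \<and> (\<forall>i<k. m (g (2 * i)) = g (2 * i + 1))"
  using assms
proof (induction "card A" arbitrary: A rule: less_induct)
  case less
  show ?case
  proof (cases "A = {}")
    case True
    then show ?thesis by (intro exI[of _ 0]) (simp add: bij_betw_def)
  next
    case False
    then obtain x where x: "x \<in> A" by blast
    let ?B = "A - {x, m x}"
    have mx: "m x \<in> A" "m x \<noteq> x" "m (m x) = x" using less.prems(2)[OF x] by auto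
    have "card ?B = card A - 2" using x mx less.prems(1) by (subst card_Diff_subset) auto
    moreover have "card {x, m x} \<le> card A" using x mx less.prems(1) by (intro card_mono) auto
    ultimately have cA: "card A = card ?B + 2" using mx by auto
    \<comment> \<open>\<open>m y\<close> is neither \<open>x\<close> nor \<open>m x\<close>, as
      applying \<open>m\<close> would make \<open>y\<close> one of them.\<close>
    have "m y \<in> ?B \<and> m y \<noteq> y \<and> m (m y) = y" if "y \<in> ?B" for y
      using less.prems(2)[of y] that mx by (auto dest: arg_cong[of _ _ m])
    then obtain k g where k: "card ?B = 2 * k" and g: "bij_betw g {..<2 * k} ?B"
      and mg: "\<forall>i<k. m (g (2 * i)) = g (2 * i + 1)"
      using less.hyps[of ?B] less.prems(1) cA by auto
    define g' where "g' = g(2 * k := x, 2 * k + 1 := m x)"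
    have "bij_betw g' {..<2 * k} ?B"
      using g by (rule bij_betw_cong[THEN iffD1, rotated]) (auto simp: g'_def)
    moreover have "bij_betw g' {2 * k, 2 * k + 1} {x, m x}"
      using mx by (auto simp: g'_def bij_betw_def inj_on_def)
    ultimately have "bij_betw g' ({..<2 * k} \<union> {2 * k, 2 * k + 1}) (?B \<union> {x, m x})"
      by (rule bij_betw_combine) auto
    moreover have "{..<2 * k} \<union> {2 * k, 2 * k + 1} = {..<2 * Suc k}" by auto
    moreover have "?B \<union> {x, m x} = A" using x mx by auto
    moreover have "m (g' (2 * i)) = g' (2 * i + 1)" if "i < Suc k" for i
      using that mg by (cases "i = k") (auto simp: g'_def)
    ultimately show ?thesis using cA k by (intro exI[of _ "Suc k"] exI[of _ g']) auto
  qed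
qed

text \<open>Two neighbours \<open>y\<close>, \<open>z\<close> of \<open>x\<close> other than
  \<open>c\<close> would give the cycle \<open>c, y, x, z\<close> with chord \<open>cx\<close>,
  while degree 2 demands at least one. Hence the edges away from \<open>c\<close> form a perfect
  matching.\<close>

lemma dominating_vertex_matching:
  assumes G: "pair_graph G" and nc: "\<not> chorded_cycle (parcs G)"
    and deg: "\<And>v. v \<in> pverts G \<Longrightarrow> 2 \<le> card (parcs G `` {v})"
    and c: "parcs G `` {c} = pverts G - {c}"
  obtains m where "\<And>x. x \<in> pverts G - {c} \<Longrightarrow>
    m x \<in> pverts G - {c} \<and> m x \<noteq> x \<and> m (m x) = x \<and> parcs G `` {x} = {c, m x}"
proof -
  note g = pair_graphD[OF G]
  let ?A = "pverts G - {c}"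
  have adj: "(c,x) \<in> parcs G" "(x,c) \<in> parcs G" if "x \<in> ?A" for x
    using c that g(3) by (auto simp: sym_def)
  have uniq: "y = z" if x: "x \<in> ?A" and y: "(x,y) \<in> parcs G" "y \<noteq> c" and z: "(x,z) \<in> parcs G" "z \<noteq> c" for x y z
  proof (rule ccontr)
    assume ne: "y \<noteq> z"
    have yz: "y \<in> ?A" "z \<in> ?A" "x \<noteq> y" "x \<noteq> z" using y z g by (auto simp: irrefl_def)
    have "chorded_cycle (parcs G)"
      using adj[OF x] adj[OF yz(1)] adj[OF yz(2)] yz ne x y z g(3)
      by (intro chorded_cycleI[of c x _ "[y]" "[z]"]) (auto simp: sym_def)
    with nc show False by blast
  qed
  have ex: "\<exists>y. (x,y) \<in> parcs G \<and> y \<noteq> c" if x: "x \<in> ?A" for x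
  proof (rule ccontr)
    assume "\<not> ?thesis"
    then have "parcs G `` {x} \<subseteq> {c}" by auto
    then have "card (parcs G `` {x}) \<le> 1" using card_mono[of "{c}"] by fastforce
    then show False using deg[of x] x by auto
  qed
  define m where "m x = (SOME y. (x,y) \<in> parcs G \<and> y \<noteq> c)" for x
  have m: "(x, m x) \<in> parcs G" "m x \<noteq> c" if "x \<in> ?A" for x
    using someI_ex[OF ex[OF that]] by (auto simp: m_def)
  show thesis
  proof (rule that)
    fix x assume x: "x \<in> ?A"
    have mA: "m x \<in> ?A" "m x \<noteq> x" using m[OF x] g by (auto simp: irrefl_def)
    have "(m x, x) \<in> parcs G" using m(1)[OF x] g(3) by (auto simp: sym_def)
    then have "m (m x) = x" using uniq[OF mA(1) m[OF mA(1)]] x by blast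
    moreover have "y = m x" if "(x,y) \<in> parcs G" "y \<noteq> c" for y using uniq[OF x that m[OF x]] .
    then have "parcs G `` {x} = {c, m x}" using adj(2)[OF x] m(1)[OF x] by auto
    ultimately show "m x \<in> ?A \<and> m x \<noteq> x \<and> m (m x) = x \<and> parcs G `` {x} = {c, m x}" using mA by blast
  qed
qed

text \<open>The involution pairs the \<open>n - 1\<close> vertices other than \<open>c\<close>,
  which makes \<open>n\<close> odd, and its consecutive enumeration supplies the leaves.\<close>

lemma graph_iso_friendship_graph:
  assumes G: "pair_graph G" and n: "card (pverts G) = n"
    and c: "c \<in> pverts G" "parcs G `` {c} = pverts G - {c}"
    and m: "\<And>x. x \<in> pverts G - {c} \<Longrightarrow>
      m x \<in> pverts G - {c} \<and> m x \<noteq> x \<and> m (m x) = x \<and> parcs G `` {x} = {c, m x}"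
  shows "odd n \<and> graph_iso G (friendship_graph n)"
proof -
  note g = pair_graphD[OF G]
  let ?A = "pverts G - {c}"
  obtain k h where k: "card ?A = 2 * k" and h: "bij_betw h {..<2 * k} ?A"
    and mh: "\<And>i. i < k \<Longrightarrow> m (h (2 * i)) = h (2 * i + 1)"
    using involution_enumeration[of ?A m] g(1) m by (metis finite_Diff)
  have nk: "n = 2 * k + 1" using k n c g(1) by (metis Suc_eq_plus1 card_Suc_Diff1)
  have hA: "h ` {..<2 * k} = ?A" and hi: "inj_on h {..<2 * k}" using h by (auto simp: bij_betw_def)
  \<comment> \<open>The centre 0 takes up one index, so the matched leaves \<open>2*i+1\<close>,
    \<open>2*i+2\<close> go to the partners \<open>h (2*i)\<close>,
    \<open>h (2*i+1)\<close>.\<close>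
  define f where "f i = (case i of 0 \<Rightarrow> c | Suc j \<Rightarrow> h j)" for i
  have f0: "f ` {0} = {c}" by (simp add: f_def)
  have S: "{1..<n} = Suc ` {..<2 * k}" using nk by (auto simp: image_Suc_lessThan)
  have f1: "f ` {1..<n} = ?A" unfolding S image_image hA[symmetric] by (simp add: f_def)
  have V: "{..<n} = {0} \<union> {1..<n}" using nk by auto
  have "inj_on f {1..<n}" unfolding S using hi by (auto simp: f_def inj_on_def)
  then have inj: "inj_on f {..<n}" unfolding V using f0 f1 by (subst inj_on_Un) (auto simp: f_def)
  have mh': "m (h (2 * i + 1)) = h (2 * i)" if "i < k" for i
  proof -
    have "h (2 * i) \<in> ?A" using hA that by auto
    then show ?thesis using m[of "h (2 * i)"] mh[OF that] by simp
  qed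
  have R: "{(2*i+1, 2*i+2) | i. 2*i+2 < n} = (\<lambda>i. (2*i+1, 2*i+2)) ` {..<k}"
    "{(2*i+2, 2*i+1) | i. 2*i+2 < n} = (\<lambda>i. (2*i+2, 2*i+1)) ` {..<k}" using nk by auto
  \<comment> \<open>Both orientations become arcs \<open>(x, m x)\<close>, with \<open>x\<close> at
    even positions of \<open>h\<close> in one and at odd positions in the other; together they cover
    \<open>?A\<close>.\<close>
  have fR: "map_prod f f ` (\<lambda>i. (2*i+1, 2*i+2)) ` {..<k} = (\<lambda>i. (h (2*i), m (h (2*i)))) ` {..<k}"
    "map_prod f f ` (\<lambda>i. (2*i+2, 2*i+1)) ` {..<k} = (\<lambda>i. (h (2*i+1), m (h (2*i+1)))) ` {..<k}"
    unfolding image_image by (intro image_cong refl; simp add: f_def mh mh'[simplified])+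
  have "{..<2 * k} = (\<lambda>i. 2 * i) ` {..<k} \<union> (\<lambda>i. 2 * i + 1) ` {..<k}"
  proof (intro set_eqI iffI)
    fix j assume "j \<in> {..<2 * k}"
    then show "j \<in> (\<lambda>i. 2 * i) ` {..<k} \<union> (\<lambda>i. 2 * i + 1) ` {..<k}"
      by (cases "even j") (auto elim!: evenE oddE)
  qed auto
  then have A: "?A = (\<lambda>i. h (2 * i)) ` {..<k} \<union> (\<lambda>i. h (2 * i + 1)) ` {..<k}"
    unfolding hA[symmetric] by (simp add: image_Un image_image)
  have "(x,y) \<in> parcs G \<longleftrightarrow> (x,y) \<in> {c} \<times> ?A \<union> ?A \<times> {c} \<union> (\<lambda>x. (x, m x)) ` ?A" for x y
  proof -
    have "(x,y) \<in> parcs G \<longleftrightarrow> x \<in> pverts G \<and> y \<in> parcs G `` {x}" using g(2) by auto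
    also have "\<dots> \<longleftrightarrow> (x,y) \<in> {c} \<times> ?A \<union> ?A \<times> {c} \<union> (\<lambda>x. (x, m x)) ` ?A"
      using c m[of x] by (cases "x = c") auto
    finally show ?thesis .
  qed
  then have "parcs G = {c} \<times> ?A \<union> ?A \<times> {c} \<union> (\<lambda>x. (x, m x)) ` ?A" by auto
  also have "(\<lambda>x. (x, m x)) ` ?A = map_prod f f ` (\<lambda>i. (2*i+1, 2*i+2)) ` {..<k}
      \<union> map_prod f f ` (\<lambda>i. (2*i+2, 2*i+1)) ` {..<k}"
    unfolding fR by (subst A) (simp only: image_Un image_image)
  finally have "parcs G = map_prod f f ` parcs (friendship_graph n)"
    unfolding friendship_graph_def pair_pre_digraph.simps R image_Un
      map_prod_surj_on[OF f0 f1] map_prod_surj_on[OF f1 f0] by blast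
  moreover have "pverts G = f ` {..<n}" unfolding V image_Un f0 f1 using c by auto
  moreover have "pair_wf_digraph (friendship_graph n)"
    using pair_graph_friendship_graph[of n] by (simp add: pair_graph_def pair_digraph_def pair_fin_digraph_def)
  ultimately have "graph_iso G (friendship_graph n)"
    using inj by (intro graph_isoI[of _ f]) (simp_all add: friendship_graph_def)
  then show ?thesis using nk by simp
qed

text \<open>Deleting a dominating \<open>c\<close> would leave a perfect matching, where only
  \<open>x\<close> and \<open>m x\<close> can be reached from \<open>x\<close>, although at least
  three vertices remain.\<close>

lemma vertex_connected_no_dominating_vertex:
  assumes G: "pair_graph G" and vc: "vertex_connected 2 G" and n: "4 \<le> card (pverts G)"
    and nc: "\<not> chorded_cycle (parcs G)" and c: "c \<in> pverts G"
  shows "parcs G `` {c} \<noteq> pverts G - {c}"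
proof
  assume dom: "parcs G `` {c} = pverts G - {c}"
  note g = pair_graphD[OF G]
  let ?A = "pverts G - {c}"
  obtain m where m: "\<And>x. x \<in> ?A \<Longrightarrow> m x \<in> ?A \<and> m x \<noteq> x \<and> m (m x) = x \<and> parcs G `` {x} = {c, m x}"
    using dominating_vertex_matching[OF G nc vertex_connected_degree_ge_2[OF G vc] dom] n by auto
  have cA: "3 \<le> card ?A" using n c g(1) by simp
  then have "?A \<noteq> {}" by (metis card.empty not_numeral_le_zero)
  then obtain x where x: "x \<in> ?A" by blast
  have "connected (induce_subgraph (with_proj G) ?A)"
    using vc c unfolding vertex_connected_def by simp
  then have conn: "\<And>y. y \<in> ?A \<Longrightarrow> (x,y) \<in> (parcs G \<inter> ?A \<times> ?A)\<^sup>*"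
    using connected_induce_iff[OF G, of ?A] x by blast
  have "y \<in> {x, m x}" if "(x,y) \<in> (parcs G \<inter> ?A \<times> ?A)\<^sup>*" for y
    using that
  proof induction
    case (step y z)
    then have "z \<in> parcs G `` {y}" "y \<in> ?A" "z \<noteq> c" by auto
    then have "z = m y" using m[of y] by auto
    then show ?case using step.IH m[OF x] by auto
  qed simp
  then have "?A \<subseteq> {x, m x}" using conn by blast
  then have "card ?A \<le> card {x, m x}" by (intro card_mono) auto
  also have "\<dots> \<le> 2" by (simp add: card_insert_if)
  finally show False using cA by simp
qed

text \<open>Separates the graphs open to the convexity bound from those with a dominating
  vertex.\<close>

lemma degree_le_or_dominating:
  assumes G: "pair_graph G" and v: "v \<in> pverts G"
  shows "card (parcs G `` {v}) \<le> card (pverts G) - 2 \<or> parcs G `` {v} = pverts G - {v}"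
proof -
  note g = pair_graphD[OF G]
  have sub: "parcs G `` {v} \<subseteq> pverts G - {v}" using g by (auto simp: irrefl_def)
  have c: "card (pverts G - {v}) = card (pverts G) - 1" using v g(1) by simp
  have "card (parcs G `` {v}) \<le> card (pverts G) - 1" using sub card_mono[OF _ sub] g(1) c by simp
  then show ?thesis using card_subset_eq[OF _ sub] g(1) c by fastforce
qed

text \<open>In the edge-connected case the maximum may come from either graph, so each alternative
  for equality carries the comparison saying that its graph attains the maximum.\<close>

theorem theorem2:
  fixes G :: "'a pair_pre_digraph" and n p :: nat
  assumes "p > 1"
    and "pair_graph G"
    and "card (pverts G) = n"
    and "n \<ge> 4"
  shows "(minimally_vertex_connected 2 G \<longrightarrow>
            degree_power p G \<le> 2 * (n - 2) ^ p + (n - 2) * 2 ^ p \<and>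
            (degree_power p G = 2 * (n - 2) ^ p + (n - 2) * 2 ^ p \<longleftrightarrow>
               graph_iso G (bipartite_graph 2 (n - 2)))) \<and>
         (minimally_edge_connected 2 G \<longrightarrow>
            degree_power p G \<le> max (degree_power p (friendship_graph n))
                                    (degree_power p (bipartite_graph 2 (n - 2))) \<and>
            (degree_power p G = max (degree_power p (friendship_graph n))
                                    (degree_power p (bipartite_graph 2 (n - 2))) \<longleftrightarrow>
               (graph_iso G (bipartite_graph 2 (n - 2)) \<and>
                  degree_power p (friendship_graph n) \<le> degree_power p (bipartite_graph 2 (n - 2))) \<or>
               (odd n \<and> graph_iso G (friendship_graph n) \<and>
                  degree_power p (bipartite_graph 2 (n - 2)) \<le> degree_power p (friendship_graph n))))"
proof (intro conjI[of "_ \<longrightarrow> _"] impI)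
  note G = assms(2) and n = assms(3,4)
  have p: "2 \<le> p" using assms(1) by simp
  let ?K = "bipartite_graph 2 (n - 2)" and ?F = "friendship_graph n"
  note K = degree_power_bipartite_graph[of p 2 "n - 2"]
  note iso = degree_power_graph_iso[OF G, of _ p]
  {
    assume min: "minimally_vertex_connected 2 G"
    then have vc: "vertex_connected 2 G" by (simp add: minimally_vertex_connected_def)
    note nc = minimally_vertex_connected_not_chorded[OF G min]
    have deg: "2 \<le> card (parcs G `` {v}) \<and> card (parcs G `` {v}) \<le> n - 2" if "v \<in> pverts G" for v
      using vertex_connected_degree_ge_2[OF G vc _ that] degree_le_or_dominating[OF G that]
        vertex_connected_no_dominating_vertex[OF G vc _ nc that] n by auto
    note * = degree_power_le_bipartite[OF G n p nc]
    show "degree_power p G \<le> 2 * (n - 2) ^ p + (n - 2) * 2 ^ p \<and>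
      (degree_power p G = 2 * (n - 2) ^ p + (n - 2) * 2 ^ p \<longleftrightarrow> graph_iso G ?K)"
      using *(1)[OF deg] *(2)[OF deg] iso[of ?K] K by metis
  next
    assume min: "minimally_edge_connected 2 G"
    then have ec: "edge_connected 2 G" by (simp add: minimally_edge_connected_def)
    note nc = minimally_edge_connected_not_chorded[OF G min]
    have deg: "2 \<le> card (parcs G `` {v})" if "v \<in> pverts G" for v
      using edge_connected_degree_ge_2[OF G ec _ that] n by auto
    consider c where "c \<in> pverts G" "parcs G `` {c} = pverts G - {c}"
      | "\<And>v. v \<in> pverts G \<Longrightarrow> card (parcs G `` {v}) \<le> n - 2"
      using degree_le_or_dominating[OF G] n by blast
    then have "(odd n \<and> graph_iso G ?F) \<or>
      degree_power p G \<le> degree_power p ?K \<and> (degree_power p G = degree_power p ?K \<longrightarrow> graph_iso G ?K)"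
    proof cases
      case 1
      obtain m where "\<And>x. x \<in> pverts G - {c} \<Longrightarrow> m x \<in> pverts G - {c} \<and> m x \<noteq> x \<and> m (m x) = x
          \<and> parcs G `` {x} = {c, m x}"
        using dominating_vertex_matching[OF G nc deg 1(2)] by blast
      from graph_iso_friendship_graph[OF G n(1) 1 this] show ?thesis by blast
    next
      case 2
      then show ?thesis using degree_power_le_bipartite[OF G n p nc] deg K by auto
    qed
    \<comment> \<open>Isomorphism makes the degree power one entry of the maximum; failing that, it
      is at most the entry of \<open>?K\<close>, with equality only for \<open>?K\<close>
      itself.\<close>
    then show "degree_power p G \<le> max (degree_power p ?F) (degree_power p ?K) \<and>
      (degree_power p G = max (degree_power p ?F) (degree_power p ?K) \<longleftrightarrow>
        (graph_iso G ?K \<and> degree_power p ?F \<le> degree_power p ?K) \<or>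
        (odd n \<and> graph_iso G ?F \<and> degree_power p ?K \<le> degree_power p ?F))"
      using iso[of ?K] iso[of ?F] by (auto simp: max_def)
  }
qed

end
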